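(* Let $\epsilon>0$ and $i\in\{1,\dots,m\}$. Then there exists a positive constant $\rho$, depending only on $\epsilon$ and on the matrix $A$, such that for every stopping time $\tau\gg\epsilon$ in $\mathcal D_i$, $$\left(e^{-A\tau}\right)_{ij}>\rho\qquad\text{for every } j\in\{1,\dots,m\}.$$
   Context: $m\ge2$ and $A=(a_{ij})$ is an $m\times m$ real matrix with $a_{ij}\le 0$ for $i\ne j$, $\sum_j a_{ij}=0$ for all $i$, and irreducible, i.e. for every nonempty $W\subsetneq\{1,\dots,m\}$ there are $i\in W$, $j\notin W$ with $a_{ij}<0$ (so $e^{-At}$ is a stochastic matrix for $t\ge0$). $\mathcal D$ is the space of càdlàg paths $\omega:[0,+\infty)\to\{1,\dots,m\}$; $\mathcal F$ is the $\sigma$-algebra generated by the sets $\{\omega:\omega(s)=i\}$, $s\ge0$, and $\mathcal F_t$ the one generated by those with $s\le t$. $\mathcal D_i=\{\omega\in\mathcal D:\omega(0)=i\}$. $\mathcal S\subset\mathbb R^m$ is the simplex of probability vectors (nonnegative components summing to 1). For $\mathbf a\in\mathcal S$, $\mathbb P_{\mathbf a}$ is the unique probability measure on $(\mathcal D,\mathcal F)$ with $\mathbb P_{\mathbf a}(\omega(t_1)=j_1,\dots,\omega(t_k)=j_k)=(\mathbf a e^{-At_1})_{j_1}\prod_{l=2}^k(e^{-A(t_l-t_{l-1})})_{j_{l-1}j_l}$ for all $0\le t_1<\dots<t_k$ and indices $j_l$ (vectors act as rows). "A.s." means up to a $\mathbb P_{\mathbf a}$-null set for some (equivalently every) $\mathbf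 a\in\mathcal S$ with all components positive. A stopping time is a random variable $\tau:\mathcal D\to[0,+\infty)$ with $\{\tau\le t\}\in\mathcal F_t$ for all $t$. For a stopping time $\tau$, $e^{-A\tau}$ denotes the $m\times m$ stochastic (deterministic) matrix such that for every $\mathbf a\in\mathcal S$, $\mathbf a\,e^{-A\tau}$ is the law of $\omega(\tau(\omega))$ under $\mathbb P_{\mathbf a}$, i.e. $(\mathbf a\,e^{-A\tau})_j=\mathbb P_{\mathbf a}(\omega(\tau)=j)$. "$\tau\gg\epsilon$ in $\mathcal D_i$" means: $\tau\ge\epsilon$ a.s. in $\mathcal D_i$ and $\{\tau\le t\}\cap\mathcal D_i\in\mathcal F_{t-\epsilon}$ for all $t\ge\epsilon$. *)

theory Defs
  imports "HOL-Probability.Probability"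
begin

text \<open>The state space \<open>{1, ..., m}\<close> is rendered by a finite type \<open>'n\<close> with \<open>m = CARD('n)\<close>.\<close>

definition coupling_matrix :: "real^'n^'n \<Rightarrow> bool" where
  "coupling_matrix A \<longleftrightarrow>
     (\<forall>i j. i \<noteq> j \<longrightarrow> A $ i $ j \<le> 0) \<and>
     (\<forall>i. (\<Sum>j\<in>UNIV. A $ i $ j) = 0) \<and>
     (\<forall>W. W \<noteq> {} \<and> W \<subset> UNIV \<longrightarrow> (\<exists>i\<in>W. \<exists>j. j \<notin> W \<and> A $ i $ j < 0))"

definition prob_simplex :: "(real^'n) set" where
  "prob_simplex = {a. (\<forall>i. 0 \<le> a $ i) \<and> (\<Sum>i\<in>UNIV. a $ i) = 1}"

definition stochastic_matrix :: "real^'n^'n \<Rightarrow> bool" where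
  "stochastic_matrix M \<longleftrightarrow> (\<forall>i. row i M \<in> prob_simplex)"

text \<open>The power series of the exponential; the type of matrices carries no multiplicative class
  structure in the library (its product is \<open>**\<close>), so the constant \<open>exp\<close> does not apply to it.\<close>

definition mat_exp :: "real^'n^'n \<Rightarrow> real^'n^'n" where
  "mat_exp M = (\<Sum>k. (1 / fact k) *\<^sub>R (((**) M ^^ k) (mat 1)))"

text \<open>Paths live on the half-line: they are \<open>extensional\<close>, so that two paths agreeing on
  \<open>{0..}\<close> are equal.  The state space carries the discrete topology.\<close>

definition cadlag_paths :: "(real \<Rightarrow> 'n) set" where
  "cadlag_paths = {\<omega> \<in> extensional {0..}.
     (\<forall>t\<ge>0. limitin (discrete_topology UNIV) \<omega> (\<omega> t) (at_right t)) \<and>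
     (\<forall>t>0. \<exists>l. limitin (discrete_topology UNIV) \<omega> l (at_left t))}"

definition path_sigma :: "(real \<Rightarrow> 'n) measure" where
  "path_sigma = sigma cadlag_paths {{\<omega> \<in> cadlag_paths. \<omega> s = i} | s i. 0 \<le> s}"

text \<open>For \<open>t < 0\<close> this is the trivial \<open>\<sigma>\<close>-algebra.\<close>

definition path_filtration :: "real \<Rightarrow> (real \<Rightarrow> 'n) measure" where
  "path_filtration t = sigma cadlag_paths {{\<omega> \<in> cadlag_paths. \<omega> s = i} | s i. 0 \<le> s \<and> s \<le> t}"

text \<open>\<open>is_path_law A a M\<close> is the characterization of \<open>M\<close> as the measure \<open>\<P>\<^sub>a\<close>
  by its finite-dimensional distributions; the times are numbered \<open>t 0 < ... < t k\<close>.\<close>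

definition is_path_law :: "real^'n^'n \<Rightarrow> real^'n \<Rightarrow> (real \<Rightarrow> 'n) measure \<Rightarrow> bool" where
  "is_path_law A a M \<longleftrightarrow>
     prob_space M \<and> sets M = sets path_sigma \<and>
     (\<forall>(k::nat) (t :: nat \<Rightarrow> real) (j :: nat \<Rightarrow> 'n).
        0 \<le> t 0 \<and> strict_mono_on {..k} t \<longrightarrow>
        measure M {\<omega> \<in> cadlag_paths. \<forall>l\<le>k. \<omega> (t l) = j l} =
          (a v* mat_exp (- t 0 *\<^sub>R A)) $ j 0 *
          (\<Prod>l<k. mat_exp (- (t (Suc l) - t l) *\<^sub>R A) $ j l $ j (Suc l)))"

text \<open>In the remaining definitions, \<open>P\<close> stands for the family \<open>a \<mapsto> \<P>\<^sub>a\<close>.\<close>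

definition almost_surely ::
    "(real^'n \<Rightarrow> (real \<Rightarrow> 'n) measure) \<Rightarrow> ((real \<Rightarrow> 'n) \<Rightarrow> bool) \<Rightarrow> bool" where
  "almost_surely P Q \<longleftrightarrow> (\<exists>a\<in>prob_simplex. (\<forall>i. 0 < a $ i) \<and> (AE \<omega> in P a. Q \<omega>))"

definition path_stopping_time :: "((real \<Rightarrow> 'n) \<Rightarrow> real) \<Rightarrow> bool" where
  "path_stopping_time \<tau> \<longleftrightarrow>
     \<tau> \<in> borel_measurable path_sigma \<and> (\<forall>\<omega>\<in>cadlag_paths. 0 \<le> \<tau> \<omega>) \<and>
     stopping_time path_filtration \<tau>"

text \<open>The matrix \<open>exp(-A\<tau>)\<close>.\<close>

definition stopped_matrix ::
    "(real^'n \<Rightarrow> (real \<Rightarrow> 'n) measure) \<Rightarrow> ((real \<Rightarrow> 'n) \<Rightarrow> real) \<Rightarrow> real^'n^'n" where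
  "stopped_matrix P \<tau> = (THE M. stochastic_matrix M \<and>
     (\<forall>a\<in>prob_simplex. \<forall>j. (a v* M) $ j = measure (P a) {\<omega> \<in> cadlag_paths. \<omega> (\<tau> \<omega>) = j}))"

text \<open>The relation \<open>\<tau> \<ggreater> \<epsilon>\<close> in \<open>\<D>\<^sub>i\<close>.\<close>

definition well_after ::
    "(real^'n \<Rightarrow> (real \<Rightarrow> 'n) measure) \<Rightarrow> 'n \<Rightarrow> ((real \<Rightarrow> 'n) \<Rightarrow> real) \<Rightarrow> real \<Rightarrow> bool" where
  "well_after P i \<tau> \<epsilon> \<longleftrightarrow>
     almost_surely P (\<lambda>\<omega>. \<omega> 0 = i \<longrightarrow> \<epsilon> \<le> \<tau> \<omega>) \<and>
     (\<forall>t\<ge>\<epsilon>. {\<omega> \<in> cadlag_paths. \<tau> \<omega> \<le> t} \<inter> {\<omega> \<in> cadlag_paths. \<omega> 0 = i}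
              \<in> sets (path_filtration (t - \<epsilon>)))"

end

theory Submission
  imports Defs
begin

text \<open>
  The hypothesis \<open>\<tau> \<ggreater> \<epsilon>\<close> says that, for paths starting in \<open>i\<close>, the decision to stop at \<open>\<tau>\<close> was
  already taken a time \<open>\<epsilon>\<close> earlier: \<open>\<sigma> = \<tau> - \<epsilon>\<close> behaves like a stopping time on \<open>\<D>\<^sub>i\<close>.  After
  \<open>\<sigma>\<close> the path runs freely for a further time \<open>\<epsilon>\<close>, so by the Markov property it is in \<open>j\<close> at time
  \<open>\<tau>\<close> with probability at least \<open>c = min\<^sub>k\<^sub>,\<^sub>l (exp(-\<epsilon>A))\<^sub>k\<^sub>l\<close>, whatever its state at time
  \<open>\<sigma>\<close>.  This \<open>c\<close> depends only on \<open>\<epsilon>\<close> and \<open>A\<close>, and it is positive because \<open>A\<close> is irreducible: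
  \<open>-\<epsilon>A\<close> is a nonnegative irreducible matrix minus a multiple of the identity, and the exponential of
  such a matrix has positive entries (\<open>mat_exp_coupling_pos\<close>).  Any \<open>\<rho> < c\<close> will do.

  The strong Markov property is avoided by discretizing \<open>\<sigma>\<close>.  Rounding \<open>\<sigma>\<close> up to the grid of mesh
  \<open>1/(n+1)\<close> gives a time \<open>\<sigma>\<^sub>n\<close> with countably many values, and \<open>{\<sigma>\<^sub>n = q} \<inter> \<D>\<^sub>i\<close> is known at time
  \<open>q\<close>.  The Markov property at the fixed time \<open>q\<close> (\<open>markov_property\<close>), summed over the grid, shows
  that the path is in \<open>j\<close> at \<open>\<sigma>\<^sub>n + \<epsilon>\<close> with probability at least \<open>c\<close>
  (\<open>markov_lower_bound_on_grid\<close>).  As \<open>\<sigma>\<^sub>n + \<epsilon>\<close> tends to \<open>\<tau>\<close> from above and paths are right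
  continuous with discrete values, \<open>\<omega>(\<sigma>\<^sub>n + \<epsilon>) = \<omega>(\<tau>)\<close> for large \<open>n\<close>, and dominated convergence
  transfers the bound to \<open>\<tau>\<close> (\<open>path_law_random_time_lower_bound\<close>).

  What the finite-dimensional distributions say about cylinders passes to all events by Dynkin's
  \<open>\<pi>\<close>-\<open>\<lambda>\<close> argument.  It is used twice: for the Markov property, and to see that \<open>\<P>\<^sub>a\<close> is the
  mixture of the laws \<open>\<P>\<^sub>i\<close> started in a fixed state (\<open>path_law_linear\<close>).  The latter shows that the
  matrix \<open>exp(-A\<tau>)\<close> exists and that its entry at \<open>(i, j)\<close> is \<open>\<P>\<^sub>i(\<omega>(\<tau>) = j)\<close>
  (\<open>stopped_matrix_entry\<close>), and that null sets for an \<open>a\<close> with positive components are null for every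
  \<open>\<P>\<^sub>i\<close>.
\<close>

section \<open>Positivity of the matrix exponential\<close>

abbreviation mat_power :: "real^'n^'n \<Rightarrow> nat \<Rightarrow> real^'n^'n" where
  "mat_power M k \<equiv> ((**) M ^^ k) (mat 1)"

lemma mat_power_Suc_entry:
  "mat_power M (Suc k) $ i $ j = (\<Sum>l\<in>UNIV. M $ i $ l * mat_power M k $ l $ j)"
  by (simp add: matrix_matrix_mult_def)

lemma mat_power_entry_bound:
  fixes M :: "real^'n^'n"
  shows "\<bar>mat_power M k $ i $ j\<bar> \<le> (\<Sum>p\<in>UNIV. \<Sum>q\<in>UNIV. \<bar>M $ p $ q\<bar>) ^ k"
proof (induction k arbitrary: i)
  case 0
  then show ?case by (simp add: mat_def)
next
  case (Suc k)
  let ?C = "\<Sum>p\<in>UNIV. \<Sum>q\<in>UNIV. \<bar>M $ p $ q\<bar>"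
  have "\<bar>mat_power M (Suc k) $ i $ j\<bar> \<le> (\<Sum>l\<in>UNIV. \<bar>M $ i $ l * mat_power M k $ l $ j\<bar>)"
    unfolding mat_power_Suc_entry by (rule sum_abs)
  also have "\<dots> \<le> (\<Sum>l\<in>UNIV. \<bar>M $ i $ l\<bar> * ?C ^ k)"
    by (intro sum_mono) (auto simp: abs_mult intro!: mult_left_mono Suc.IH)
  also have "\<dots> = (\<Sum>l\<in>UNIV. \<bar>M $ i $ l\<bar>) * ?C ^ k"
    by (simp add: sum_distrib_right)
  also have "\<dots> \<le> ?C * ?C ^ k"
    by (intro mult_right_mono member_le_sum[where f = "\<lambda>p. \<Sum>q\<in>UNIV. \<bar>M $ p $ q\<bar>"])
       (auto intro!: sum_nonneg zero_le_power)
  finally show ?case by simp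
qed

lemma summable_abs_mat_power_entry:
  fixes M :: "real^'n^'n"
  shows "summable (\<lambda>k. \<bar>mat_power M k $ i $ j / fact k\<bar>)"
proof (rule summable_comparison_test')
  let ?C = "\<Sum>p\<in>UNIV. \<Sum>q\<in>UNIV. \<bar>M $ p $ q\<bar>"
  show "summable (\<lambda>k. inverse (fact k) * ?C ^ k)" by (rule summable_exp)
  show "norm \<bar>mat_power M k $ i $ j / fact k\<bar> \<le> inverse (fact k) * ?C ^ k" for k
    using mat_power_entry_bound[of k M i j] by (simp add: divide_simps)
qed

lemma mat_exp_entry_sums:
  fixes M :: "real^'n^'n"
  shows "(\<lambda>k. mat_power M k $ i $ j / fact k) sums (mat_exp M $ i $ j)"
proof -
  define S :: "real^'n^'n" where "S = (\<chi> i j. \<Sum>k. mat_power M k $ i $ j / fact k)"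
  have entry: "(\<lambda>k. mat_power M k $ i $ j / fact k) sums (S $ i $ j)" for i j
    unfolding S_def
    using summable_sums[OF summable_rabs_cancel[OF summable_abs_mat_power_entry[of M i j]]] by simp
  have "(\<lambda>k. (1 / fact k) *\<^sub>R mat_power M k) sums S"
    unfolding sums_def
  proof (intro vec_tendstoI)
    fix i j
    show "(\<lambda>n. (\<Sum>k<n. (1 / fact k) *\<^sub>R mat_power M k) $ i $ j) \<longlonglongrightarrow> S $ i $ j"
      using entry[of i j] by (simp add: sums_def)
  qed
  then have "mat_exp M = S"
    unfolding mat_exp_def by (rule sums_unique[symmetric])
  with entry show ?thesis by simp
qed

text \<open>The binomial expansion of \<open>(B - cI)\<^sup>k / k!\<close>, arranged as a Cauchy product.  The induction step
  mirrors the Leibniz rule: on the right-hand side, multiplying by \<open>k + 1 = l + (k + 1 - l)\<close> acts on one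
  factor at a time and produces \<open>-c\<close> from the first and \<open>B\<close> from the second.\<close>
lemma mat_power_shift_entry:
  fixes B :: "real^'n^'n"
  shows "mat_power (B - mat c) k $ i $ j / fact k =
    (\<Sum>l\<le>k. ((- c) ^ l / fact l) * (mat_power B (k - l) $ i $ j / fact (k - l)))"
proof (induction k arbitrary: i)
  case 0
  then show ?case by simp
next
  case (Suc k)
  define a where "a l = (- c) ^ l / fact l" for l
  define b where "b p l = mat_power B l $ p $ j / fact l" for p l
  have a_Suc: "real (Suc l) * a (Suc l) = - c * a l" for l
    by (simp add: a_def divide_simps)
  have b_Suc: "real (Suc l) * b i (Suc l) = (\<Sum>p\<in>UNIV. B $ i $ p * b p l)" for l
    unfolding b_def mat_power_Suc_entry
    by (simp add: divide_simps sum_distrib_left sum_divide_distrib)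
  have "real (Suc k) * (\<Sum>l\<le>Suc k. a l * b i (Suc k - l)) =
      (\<Sum>l\<le>Suc k. real l * a l * b i (Suc k - l)) +
      (\<Sum>l\<le>Suc k. a l * (real (Suc k - l) * b i (Suc k - l)))"
    unfolding sum_distrib_left sum.distrib[symmetric]
    by (intro sum.cong) (auto simp: algebra_simps of_nat_diff)
  also have "(\<Sum>l\<le>Suc k. real l * a l * b i (Suc k - l)) =
      - c * (\<Sum>l\<le>k. a l * b i (k - l))"
    unfolding sum.atMost_Suc_shift sum_distrib_left
    by (simp add: a_Suc mult.assoc del: of_nat_Suc)
  also have "(\<Sum>l\<le>Suc k. a l * (real (Suc k - l) * b i (Suc k - l))) =
      (\<Sum>l\<le>k. a l * (\<Sum>p\<in>UNIV. B $ i $ p * b p (k - l)))"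
    by (simp add: Suc_diff_le b_Suc del: of_nat_Suc of_nat_diff)
  also have "\<dots> = (\<Sum>p\<in>UNIV. B $ i $ p * (\<Sum>l\<le>k. a l * b p (k - l)))"
    unfolding sum_distrib_left by (subst sum.swap) (simp add: mult_ac)
  also have "- c * (\<Sum>l\<le>k. a l * b i (k - l)) + \<dots> =
      (\<Sum>p\<in>UNIV. (B - mat c) $ i $ p * (\<Sum>l\<le>k. a l * b p (k - l)))"
  proof -
    have entry: "(B - mat c) $ i $ p * x = B $ i $ p * x - (if i = p then c * x else 0)" for p x
      by (simp add: mat_def algebra_simps)
    show ?thesis unfolding entry by (simp add: sum_subtractf)
  qed
  also have "\<dots> = (\<Sum>p\<in>UNIV. (B - mat c) $ i $ p * (mat_power (B - mat c) k $ p $ j / fact k))"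
    using Suc.IH unfolding a_def b_def by simp
  also have "\<dots> = mat_power (B - mat c) (Suc k) $ i $ j / fact k"
    unfolding mat_power_Suc_entry by (simp add: sum_divide_distrib)
  also have "\<dots> = real (Suc k) * (mat_power (B - mat c) (Suc k) $ i $ j / fact (Suc k))"
    by (simp add: divide_simps)
  finally have "(\<Sum>l\<le>Suc k. a l * b i (Suc k - l)) =
      mat_power (B - mat c) (Suc k) $ i $ j / fact (Suc k)"
    by (rule mult_left_cancel[THEN iffD1, rotated]) (simp del: of_nat_Suc)
  then show ?case
    unfolding a_def b_def by (rule sym)
qed

lemma mat_exp_shift_entry:
  fixes B :: "real^'n^'n"
  shows "mat_exp (B - mat c) $ i $ j = exp (- c) * mat_exp B $ i $ j"
proof -
  have "summable (\<lambda>l. norm ((- c) ^ l / fact l))"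
    using summable_norm_exp[of "- c"] by (simp add: divide_inverse mult.commute)
  then have "(\<lambda>k. \<Sum>l\<le>k. ((- c) ^ l / fact l) * (mat_power B (k - l) $ i $ j / fact (k - l))) sums
     ((\<Sum>l. (- c) ^ l / fact l) * (\<Sum>l. mat_power B l $ i $ j / fact l))"
    by (rule Cauchy_product_sums) (use summable_abs_mat_power_entry[of B i j] in simp)
  also have "(\<Sum>l. (- c) ^ l / fact l) = exp (- c)"
    by (simp add: exp_def divide_inverse mult.commute)
  also have "(\<Sum>l. mat_power B l $ i $ j / fact l) = mat_exp B $ i $ j"
    using mat_exp_entry_sums by (rule sums_unique[symmetric])
  finally have "(\<lambda>k. mat_power (B - mat c) k $ i $ j / fact k) sums (exp (- c) * mat_exp B $ i $ j)"
    unfolding mat_power_shift_entry .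
  with mat_exp_entry_sums show ?thesis by (rule sums_unique2)
qed

lemma mat_power_nonneg:
  assumes "\<And>i j. 0 \<le> B $ i $ j"
  shows "0 \<le> mat_power B k $ i $ j"
proof (induction k arbitrary: i)
  case 0
  then show ?case by (simp add: mat_def)
next
  case (Suc k)
  then show ?case unfolding mat_power_Suc_entry by (auto intro!: sum_nonneg mult_nonneg_nonneg assms)
qed

text \<open>If no power of \<open>B\<close> had a positive entry at \<open>(i, j)\<close>, the states that cannot reach \<open>j\<close> would
  form a set that contains \<open>i\<close> but not \<open>j\<close>, and irreducibility would give an edge leading out of
  it.\<close>
lemma mat_power_entry_pos:
  fixes B :: "real^'n^'n"
  assumes nonneg: "\<And>i j. 0 \<le> B $ i $ j"
    and irred: "\<And>W. W \<noteq> {} \<Longrightarrow> W \<subset> UNIV \<Longrightarrow> \<exists>i\<in>W. \<exists>j. j \<notin> W \<and> 0 < B $ i $ j"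
  shows "\<exists>k. 0 < mat_power B k $ i $ j"
proof (rule ccontr)
  define W where "W = {i. \<forall>k. mat_power B k $ i $ j = 0}"
  assume "\<nexists>k. 0 < mat_power B k $ i $ j"
  then have "i \<in> W"
    unfolding W_def using mat_power_nonneg[of B _ i j, OF nonneg] by (auto simp: less_le)
  moreover have "j \<notin> W"
    unfolding W_def by (auto simp: mat_def intro!: exI[of _ 0])
  ultimately obtain p q where pq: "p \<in> W" "q \<notin> W" "0 < B $ p $ q"
    using irred[of W] by blast
  from pq(2) obtain k where "mat_power B k $ q $ j \<noteq> 0"
    unfolding W_def by blast
  then have "0 < mat_power B k $ q $ j"
    using mat_power_nonneg[of B k q j, OF nonneg] by simp
  then have "0 < (\<Sum>l\<in>UNIV. B $ p $ l * mat_power B k $ l $ j)"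
    using pq(3) by (intro sum_pos2[of _ q]) (auto intro!: mult_nonneg_nonneg nonneg mat_power_nonneg)
  then have "0 < mat_power B (Suc k) $ p $ j"
    unfolding mat_power_Suc_entry .
  moreover have "mat_power B (Suc k) $ p $ j = 0"
    using pq(1) unfolding W_def by blast
  ultimately show False by simp
qed

text \<open>Adding a large multiple \<open>c\<close> of the identity makes \<open>-tA\<close> nonnegative, so that all terms of the
  exponential series become nonnegative; by \<open>mat_exp_shift_entry\<close> this changes the exponential only by
  the positive factor \<open>exp c\<close>.\<close>
lemma mat_exp_coupling_pos:
  fixes A :: "real^'n^'n"
  assumes A: "coupling_matrix A" and t: "0 < t"
  shows "0 < mat_exp (- t *\<^sub>R A) $ i $ j"
proof -
  define c where "c = (\<Sum>p\<in>UNIV. t * \<bar>A $ p $ p\<bar>)"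
  define B where "B = mat c - t *\<^sub>R A"
  have off: "A $ p $ q \<le> 0" if "p \<noteq> q" for p q
    using A that unfolding coupling_matrix_def by blast
  have diag: "t * A $ p $ p \<le> c" for p
  proof -
    have "t * A $ p $ p \<le> t * \<bar>A $ p $ p\<bar>" using t by simp
    also have "\<dots> \<le> c" unfolding c_def using t by (intro member_le_sum) auto
    finally show ?thesis .
  qed
  have nonneg: "0 \<le> B $ p $ q" for p q
    using diag[of p] off[of p q] t by (auto simp: B_def mat_def mult_le_0_iff)
  have irred: "\<exists>p\<in>W. \<exists>q. q \<notin> W \<and> 0 < B $ p $ q" if W: "W \<noteq> {}" "W \<subset> UNIV" for W
  proof -
    from A have "\<forall>W. W \<noteq> {} \<and> W \<subset> UNIV \<longrightarrow> (\<exists>i\<in>W. \<exists>j. j \<notin> W \<and> A $ i $ j < 0)"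
      unfolding coupling_matrix_def by (elim conjE)
    with W obtain p q where pq: "p \<in> W" "q \<notin> W" "A $ p $ q < 0"
      by meson
    then have "p \<noteq> q" by auto
    with pq(3) t have "0 < B $ p $ q"
      by (simp add: B_def mat_def mult_less_0_iff)
    with pq show ?thesis by blast
  qed
  obtain k where k: "0 < mat_power B k $ i $ j"
    using mat_power_entry_pos[OF nonneg irred] by blast
  have "0 < (\<Sum>k. mat_power B k $ i $ j / fact k)"
    using k by (intro suminf_pos2[of _ k] sums_summable[OF mat_exp_entry_sums] divide_nonneg_pos
        mat_power_nonneg nonneg) auto
  also have "\<dots> = mat_exp B $ i $ j"
    using mat_exp_entry_sums by (rule sums_unique[symmetric])
  finally have "0 < exp (- c) * mat_exp B $ i $ j" by simp
  also have "\<dots> = mat_exp (- t *\<^sub>R A) $ i $ j"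
    unfolding mat_exp_shift_entry[symmetric] by (simp add: B_def)
  finally show ?thesis .
qed

lemma mat_exp_zero: "mat_exp (0 :: real^'n^'n) = mat 1"
proof -
  have pow: "mat_power (0 :: real^'n^'n) k $ i $ j = 0" if "k > 0" for k i j
    using that by (cases k) (auto simp: mat_power_Suc_entry simp del: funpow.simps)
  have "mat_exp (0 :: real^'n^'n) $ i $ j = mat 1 $ i $ j" for i j
  proof -
    have "(\<lambda>k. mat_power (0 :: real^'n^'n) k $ i $ j / fact k) =
        (\<lambda>k. if k = 0 then mat 1 $ i $ j else 0)"
      using pow by (auto simp: fun_eq_iff)
    then show ?thesis
      using sums_unique2[OF mat_exp_entry_sums[of 0 i j] ] sums_single[of 0 "\<lambda>_. mat 1 $ i $ j :: real"]
      by simp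
  qed
  then show ?thesis by (simp add: vec_eq_iff)
qed

section \<open>Cylinders and the Markov property at a fixed time\<close>

definition cylinder :: "real set \<Rightarrow> (real \<Rightarrow> 'n) \<Rightarrow> (real \<Rightarrow> 'n) set" where
  "cylinder T f = {\<omega> \<in> cadlag_paths. \<forall>s\<in>T. \<omega> s = f s}"

text \<open>The empty set is included so that the family is closed under intersection: two cylinders may
  prescribe different states at the same time.\<close>
definition cylinders :: "real set \<Rightarrow> (real \<Rightarrow> 'n) set set" where
  "cylinders I = insert {} {cylinder T f | T f. finite T \<and> T \<subseteq> I}"

lemma cylinders_cases:
  assumes "B \<in> cylinders I"
  obtains "B = {}" | T f where "B = cylinder T f" "finite T" "T \<subseteq> I"
  using assms unfolding cylinders_def by auto

lemma cylinder_in_cylinders: "finite T \<Longrightarrow> T \<subseteq> I \<Longrightarrow> cylinder T f \<in> cylinders I"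
  unfolding cylinders_def by auto

lemma cylinders_into: "cylinders I \<subseteq> Pow cadlag_paths"
  unfolding cylinders_def cylinder_def by auto

lemma cadlag_paths_in_cylinders: "cadlag_paths \<in> cylinders I"
  using cylinder_in_cylinders[of "{}" I undefined] by (simp add: cylinder_def)

lemma Int_stable_cylinders: "Int_stable (cylinders I)"
proof (rule Int_stableI)
  fix B C :: "(real \<Rightarrow> 'n) set"
  assume B: "B \<in> cylinders I" and C: "C \<in> cylinders I"
  show "B \<inter> C \<in> cylinders I"
  proof (cases "B \<inter> C = {}")
    case True
    then show ?thesis by (simp add: cylinders_def)
  next
    case False
    then have "B \<noteq> {}" "C \<noteq> {}" by auto
    obtain T f where T: "B = cylinder T f" "finite T" "T \<subseteq> I"
      using B by (rule cylinders_cases) (use \<open>B \<noteq> {}\<close> in auto)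
    obtain T' f' where T': "C = cylinder T' f'" "finite T'" "T' \<subseteq> I"
      using C by (rule cylinders_cases) (use \<open>C \<noteq> {}\<close> in auto)
    from False obtain \<omega> where "\<omega> \<in> B" "\<omega> \<in> C" by auto
    \<comment> \<open>A common path prescribes states that are compatible with both cylinders.\<close>
    then have "B \<inter> C = cylinder (T \<union> T') \<omega>"
      unfolding T T' cylinder_def by auto
    then show ?thesis
      using T T' by (auto intro: cylinder_in_cylinders)
  qed
qed

lemma sigma_sets_coordinates_eq_cylinders:
  "sigma_sets cadlag_paths {{\<omega> \<in> cadlag_paths. \<omega> s = i} | s i. s \<in> I} =
   sigma_sets cadlag_paths (cylinders I)" (is "sigma_sets _ ?G = _")
proof (rule sigma_sets_eqI)
  interpret sigma_algebra cadlag_paths "sigma_sets cadlag_paths ?G"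
    by (rule sigma_algebra_sigma_sets) auto
  have cyl: "cylinder T f \<in> sigma_sets cadlag_paths ?G" if "finite T" "T \<subseteq> I" for T f
    using that
  proof (induction T rule: finite_induct)
    case empty
    have "cylinder {} f = cadlag_paths"
      by (simp add: cylinder_def)
    then show ?case by (simp add: sigma_sets_top)
  next
    case (insert s T)
    have "cylinder (insert s T) f = {\<omega> \<in> cadlag_paths. \<omega> s = f s} \<inter> cylinder T f"
      unfolding cylinder_def by auto
    moreover have "{\<omega> \<in> cadlag_paths. \<omega> s = f s} \<in> sigma_sets cadlag_paths ?G"
      using insert.prems by (intro sigma_sets.Basic) auto
    moreover have "cylinder T f \<in> sigma_sets cadlag_paths ?G"
      using insert by blast
    ultimately show ?case
      by (simp only: Int)
  qed
  show "B \<in> sigma_sets cadlag_paths ?G" if "B \<in> cylinders I" for B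
    using that cyl by (auto elim!: cylinders_cases intro: sigma_sets.Empty)
  show "B \<in> sigma_sets cadlag_paths (cylinders I)" if B: "B \<in> ?G" for B
  proof -
    from B obtain s i where si: "s \<in> I" "B = {\<omega> \<in> cadlag_paths. \<omega> s = i}"
      by auto
    then have "B = cylinder {s} (\<lambda>_. i)"
      by (auto simp: cylinder_def)
    then have "B \<in> cylinders I"
      using si(1) by (simp only:) (rule cylinder_in_cylinders, auto)
    then show ?thesis
      by (rule sigma_sets.Basic)
  qed
qed

lemma space_path_sigma: "space path_sigma = cadlag_paths"
  unfolding path_sigma_def by (rule space_measure_of) auto

lemma sets_path_sigma: "sets path_sigma = sigma_sets cadlag_paths (cylinders {0..})"
proof -
  have "sets path_sigma = sigma_sets cadlag_paths {{\<omega> \<in> cadlag_paths. \<omega> s = i} | s i. s \<in> {0..}}"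
    unfolding path_sigma_def by (subst sets_measure_of) auto
  then show ?thesis
    unfolding sigma_sets_coordinates_eq_cylinders .
qed

lemma sets_path_filtration: "sets (path_filtration t) = sigma_sets cadlag_paths (cylinders {0..t})"
proof -
  have "sets (path_filtration t) =
      sigma_sets cadlag_paths {{\<omega> \<in> cadlag_paths. \<omega> s = i} | s i. s \<in> {0..t}}"
    unfolding path_filtration_def by (subst sets_measure_of) auto
  then show ?thesis
    unfolding sigma_sets_coordinates_eq_cylinders .
qed

lemma cylinders_mono: "I \<subseteq> J \<Longrightarrow> cylinders I \<subseteq> cylinders J"
  unfolding cylinders_def by blast

lemma sets_path_filtration_mono: "s \<le> t \<Longrightarrow> sets (path_filtration s) \<subseteq> sets (path_filtration t)"
  unfolding sets_path_filtration by (intro sigma_sets_mono' cylinders_mono) auto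

lemma sets_path_filtration_path_sigma: "sets (path_filtration t) \<subseteq> sets path_sigma"
  unfolding sets_path_filtration sets_path_sigma by (intro sigma_sets_mono' cylinders_mono) auto

lemma coordinate_set_in_path_sigma:
  assumes "0 \<le> s"
  shows "{\<omega> \<in> cadlag_paths. \<omega> s = i} \<in> sets path_sigma"
  using assms unfolding path_sigma_def by (subst sets_measure_of) (auto intro!: sigma_sets.Basic)

text \<open>Uniqueness of measures, stated for a signed set function: applied to a difference of two set
  functions it extends an identity from cylinders to all events, and allows the two sides to be
  combinations of several measures.  Inequalities do not pass to complements, so the Markov property
  is extended in this way as an equality.\<close>
lemma countably_additive_zero_on_sigma_sets:
  fixes d :: "'a set \<Rightarrow> real"
  assumes stable: "Int_stable G" and G: "G \<subseteq> Pow \<Omega>" and top: "\<Omega> \<in> G"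
    and additive: "\<And>S. range S \<subseteq> sigma_sets \<Omega> G \<Longrightarrow> disjoint_family S \<Longrightarrow>
      (\<lambda>n. d (S n)) sums d (\<Union>n. S n)"
    and zero: "\<And>B. B \<in> G \<Longrightarrow> d B = 0"
    and B: "B \<in> sigma_sets \<Omega> G"
  shows "d B = 0"
proof -
  have empty: "d {} = 0"
  proof -
    have "(\<lambda>n::nat. d {}) sums d {}"
      using additive[of "\<lambda>_. {}"] by (simp add: sigma_sets.Empty disjoint_family_on_def)
    then show ?thesis
      using summable_const_iff[of "d {}"] sums_summable by blast
  qed
  show ?thesis
    using stable G B
  proof (induction rule: sigma_sets_induct_disjoint)
    case (basic B)
    then show ?case by (rule zero)
  next
    case empty
    then show ?case by (rule \<open>d {} = 0\<close>)
  next
    case (compl B)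
    have sub: "B \<subseteq> \<Omega>"
      using compl.hyps sigma_sets_into_sp[OF G] by blast
    have "range (binaryset B (\<Omega> - B)) \<subseteq> sigma_sets \<Omega> G"
      using compl.hyps by (auto simp: range_binaryset_eq intro: sigma_sets.intros)
    moreover have "disjoint_family (binaryset B (\<Omega> - B))"
      by (auto simp: disjoint_family_on_def binaryset_def)
    ultimately have "(\<lambda>n. d (binaryset B (\<Omega> - B) n)) sums d (B \<union> (\<Omega> - B))"
      using additive unfolding UN_binaryset_eq[symmetric] by blast
    then have "d (B \<union> (\<Omega> - B)) = d B + d (\<Omega> - B)"
      using binaryset_sums[of d, OF empty] by (rule sums_unique2)
    then show ?case
      using sub zero[OF top] compl.IH by (simp add: Un_absorb1)
  next
    case (union S)
    then have "(\<lambda>n. d (S n)) sums d (\<Union>n. S n)"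
      by (intro additive) auto
    then have "(\<lambda>n. 0) sums d (\<Union>n. S n)"
      using union by simp
    then show ?case
      using sums_unique2 sums_zero by blast
  qed
qed

lemma path_law_prob_space: "is_path_law A a M \<Longrightarrow> prob_space M"
  and path_law_sets: "is_path_law A a M \<Longrightarrow> sets M = sets path_sigma"
  unfolding is_path_law_def by auto

lemma path_law_space: "is_path_law A a M \<Longrightarrow> space M = cadlag_paths"
  using sets_eq_imp_space_eq[OF path_law_sets] space_path_sigma by blast

lemma path_law_cylinder:
  fixes t :: "nat \<Rightarrow> real"
  assumes "is_path_law A a M" "0 \<le> t 0" "strict_mono_on {..k} t"
  shows "measure M (cylinder (t ` {..k}) f) =
    (a v* mat_exp (- t 0 *\<^sub>R A)) $ f (t 0) *
    (\<Prod>l<k. mat_exp (- (t (Suc l) - t l) *\<^sub>R A) $ f (t l) $ f (t (Suc l)))"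
proof -
  have "cylinder (t ` {..k}) f = {\<omega> \<in> cadlag_paths. \<forall>l\<le>k. \<omega> (t l) = f (t l)}"
    unfolding cylinder_def by auto
  then show ?thesis
    using assms(1)[unfolded is_path_law_def, THEN conjunct2, THEN conjunct2, rule_format,
        of t k "\<lambda>l. f (t l)"] assms(2,3) by simp
qed

lemma strict_mono_on_extend:
  fixes t :: "nat \<Rightarrow> real"
  assumes "strict_mono_on {..k} t" "t k < b"
  shows "strict_mono_on {..Suc k} (t(Suc k := b))"
proof (rule strict_mono_onI)
  fix r s assume rs: "r \<in> {..Suc k}" "s \<in> {..Suc k}" "r < s"
  have "t r < b" if "r \<le> k"
  proof -
    have "t r \<le> t k"
      using strict_mono_on_leD[OF assms(1)] that by auto
    with assms(2) show ?thesis by simp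
  qed
  then show "(t(Suc k := b)) r < (t(Suc k := b)) s"
    using rs strict_mono_onD[OF assms(1), of r s] by auto
qed

lemma image_extend: "(t(Suc k := b)) ` {..Suc k} = insert b (t ` {..k})"
  by (auto simp: atMost_Suc image_def)

text \<open>The finite-dimensional distributions are given for increasing sequences of times, whereas
  cylinders are indexed by finite sets of times.\<close>
lemma finite_increasing_enumeration:
  fixes T :: "real set"
  assumes "finite T" "T \<noteq> {}"
  shows "\<exists>(k::nat) t. strict_mono_on {..k} t \<and> t ` {..k} = T"
  using assms
proof (induction T rule: finite_linorder_max_induct)
  case empty
  then show ?case by simp
next
  case (insert b T)
  show ?case
  proof (cases "T = {}")
    case True
    have "strict_mono_on {..0::nat} (\<lambda>_. b)" "(\<lambda>_. b) ` {..0::nat} = insert b T"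
      using True by (auto intro!: strict_mono_onI)
    then show ?thesis by blast
  next
    case False
    then obtain k :: nat and t where kt: "strict_mono_on {..k} t" "t ` {..k} = T"
      using insert.IH by auto
    then have "t k < b"
      using insert.hyps by auto
    then have "strict_mono_on {..Suc k} (t(Suc k := b))"
      "(t(Suc k := b)) ` {..Suc k} = insert b T"
      using strict_mono_on_extend[OF kt(1)] image_extend[of t k b] kt(2) by auto
    then show ?thesis by blast
  qed
qed

lemma axis_in_prob_simplex: "axis i 1 \<in> prob_simplex"
  by (auto simp: prob_simplex_def axis_def)

text \<open>The finite-dimensional distributions depend linearly on the initial vector.\<close>
lemma path_law_linear:
  fixes A :: "real^'n^'n"
  assumes law: "\<And>a. a \<in> prob_simplex \<Longrightarrow> is_path_law A a (P a)"
    and a: "a \<in> prob_simplex" and B: "B \<in> sets path_sigma"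
  shows "measure (P a) B = (\<Sum>i\<in>UNIV. a $ i * measure (P (axis i 1)) B)"
proof -
  let ?e = "\<lambda>i::'n. axis i 1 :: real^'n"
  have e: "?e i \<in> prob_simplex" for i
    by (rule axis_in_prob_simplex)
  interpret Pa: prob_space "P a" using law[OF a] by (rule path_law_prob_space)
  have Pe: "prob_space (P (?e i))" for i using law[OF e] by (rule path_law_prob_space)
  define d where "d B = measure (P a) B - (\<Sum>i\<in>UNIV. a $ i * measure (P (?e i)) B)" for B
  have "d B = 0"
  proof (rule countably_additive_zero_on_sigma_sets[OF Int_stable_cylinders cylinders_into
        cadlag_paths_in_cylinders])
    show "B \<in> sigma_sets cadlag_paths (cylinders {0..})"
      using B unfolding sets_path_sigma .
  next
    fix S :: "nat \<Rightarrow> (real \<Rightarrow> 'n) set"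
    assume S: "range S \<subseteq> sigma_sets cadlag_paths (cylinders {0..})" and disj: "disjoint_family S"
    have sums: "(\<lambda>n. measure (P x) (S n)) sums measure (P x) (\<Union>n. S n)"
      if x: "x \<in> prob_simplex" for x
    proof -
      interpret prob_space "P x" using law[OF x] by (rule path_law_prob_space)
      show ?thesis
        using S disj unfolding sets_path_sigma[symmetric] path_law_sets[OF law[OF x], symmetric]
        by (rule finite_measure_UNION)
    qed
    show "(\<lambda>n. d (S n)) sums d (\<Union>n. S n)"
      unfolding d_def by (intro sums_diff sums_sum sums_mult sums a e)
  next
    fix B :: "(real \<Rightarrow> 'n) set" assume "B \<in> cylinders {0..}"
    then show "d B = 0"
    proof (cases rule: cylinders_cases)
      case 1
      then show ?thesis by (simp add: d_def)
    next
      case (2 T f)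
      show ?thesis
      proof (cases "T = {}")
        case True
        then have "B = cadlag_paths"
          using 2 by (simp add: cylinder_def)
        then have "measure (P x) B = 1" if "x \<in> prob_simplex" for x
          using prob_space.prob_space[OF path_law_prob_space[OF law[OF that]]]
            path_law_space[OF law[OF that]] by simp
        then show ?thesis
          using a e unfolding d_def by (simp add: prob_simplex_def)
      next
        case False
        then obtain k :: nat and t where kt: "strict_mono_on {..k} t" "t ` {..k} = T"
          using finite_increasing_enumeration 2 by blast
        have t0: "0 \<le> t 0"
          using kt(2) 2 by auto
        note val = path_law_cylinder[OF law t0 kt(1), of _ f, unfolded kt(2)]
        show ?thesis
          unfolding d_def 2 using val[OF a] val[OF e]
          by (simp add: vector_matrix_mult_def axis_def if_distrib if_distribR sum_distrib_right
              mult_ac cong: if_cong)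
      qed
    qed
  qed
  then show ?thesis by (simp add: d_def)
qed

text \<open>Observing the path at one more time, later by \<open>s\<close> than all others, adds one factor to the product
  that describes the law.\<close>
lemma markov_cylinder:
  fixes A :: "real^'n^'n"
  assumes law: "is_path_law A a M" and T: "finite T" "T \<subseteq> {0..q}" "q \<in> T" and s: "0 < s"
  shows "measure M (cylinder (insert (q + s) T) f) =
    measure M (cylinder T f) * mat_exp (- s *\<^sub>R A) $ f q $ f (q + s)"
proof -
  obtain k :: nat and t where kt: "strict_mono_on {..k} t" "t ` {..k} = T"
    using finite_increasing_enumeration T by blast
  have tk: "t k = q"
  proof (rule antisym)
    show "t k \<le> q" using kt(2) T(2) by auto
    obtain l where "l \<le> k" "t l = q" using kt(2) T(3) by auto
    then show "q \<le> t k" using strict_mono_on_leD[OF kt(1), of l k] by auto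
  qed
  have t0: "0 \<le> t 0"
    using kt(2) T by auto
  define u where "u = t(Suc k := q + s)"
  have u: "strict_mono_on {..Suc k} u" "u ` {..Suc k} = insert (q + s) T" "0 \<le> u 0"
    using strict_mono_on_extend[OF kt(1), of "q + s"] image_extend[of t k "q + s"] kt(2) s tk t0
    by (auto simp: u_def)
  have "(\<Prod>l<k. mat_exp (- (u (Suc l) - u l) *\<^sub>R A) $ f (u l) $ f (u (Suc l))) =
      (\<Prod>l<k. mat_exp (- (t (Suc l) - t l) *\<^sub>R A) $ f (t l) $ f (t (Suc l)))"
    by (intro prod.cong) (auto simp: u_def)
  then show ?thesis
    using path_law_cylinder[OF law u(3) u(1), of f] path_law_cylinder[OF law t0 kt(1), of f]
    unfolding u(2) kt(2) by (simp add: u_def tk)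
qed

text \<open>Intersecting a cylinder over \<open>[0, q]\<close> with \<open>{\<omega>(q) = k}\<close> makes \<open>q\<close> its last time (or makes it
  empty), so \<open>markov_cylinder\<close> applies; both sides are countably additive in \<open>B\<close>.\<close>
lemma markov_property:
  fixes A :: "real^'n^'n"
  assumes law: "is_path_law A a M" and q: "0 \<le> q" and s: "0 < s"
    and B: "B \<in> sets (path_filtration q)"
  shows "measure M (B \<inter> {\<omega> \<in> cadlag_paths. \<omega> q = k} \<inter> {\<omega> \<in> cadlag_paths. \<omega> (q + s) = j}) =
    measure M (B \<inter> {\<omega> \<in> cadlag_paths. \<omega> q = k}) * mat_exp (- s *\<^sub>R A) $ k $ j"
proof -
  interpret prob_space M using law by (rule path_law_prob_space)
  let ?G = "{\<omega> \<in> cadlag_paths. \<omega> q = k}" and ?H = "{\<omega> \<in> cadlag_paths. \<omega> (q + s) = j}"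
  let ?K = "mat_exp (- s *\<^sub>R A) $ k $ j"
  have GH: "?G \<in> sets M" "?H \<in> sets M"
    using q s coordinate_set_in_path_sigma[of q k] coordinate_set_in_path_sigma[of "q + s" j]
    unfolding path_law_sets[OF law] by auto
  define d where "d B = measure M (B \<inter> ?G \<inter> ?H) - measure M (B \<inter> ?G) * ?K" for B
  have "d B = 0"
  proof (rule countably_additive_zero_on_sigma_sets[OF Int_stable_cylinders cylinders_into
        cadlag_paths_in_cylinders])
    show "B \<in> sigma_sets cadlag_paths (cylinders {0..q})"
      using B unfolding sets_path_filtration .
  next
    fix S :: "nat \<Rightarrow> (real \<Rightarrow> 'n) set"
    assume S: "range S \<subseteq> sigma_sets cadlag_paths (cylinders {0..q})" and disj: "disjoint_family S"
    then have "range S \<subseteq> sets M"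
      unfolding path_law_sets[OF law] sets_path_filtration[symmetric]
      using sets_path_filtration_path_sigma by blast
    then have sums: "(\<lambda>n. measure M (S n \<inter> C)) sums measure M (\<Union>n. S n \<inter> C)"
      if "C \<in> sets M" for C
      using disj that by (intro finite_measure_UNION) (auto simp: disjoint_family_on_def)
    show "(\<lambda>n. d (S n)) sums d (\<Union>n. S n)"
      unfolding d_def using sums[of "?G \<inter> ?H"] sums[of ?G] GH
      by (intro sums_diff sums_mult2) (auto simp: Int_assoc)
  next
    fix B :: "(real \<Rightarrow> 'n) set" assume "B \<in> cylinders {0..q}"
    then show "d B = 0"
    proof (cases rule: cylinders_cases)
      case 1
      then show ?thesis by (simp add: d_def)
    next
      case (2 T f)
      show ?thesis
      proof (cases "q \<in> T \<and> f q \<noteq> k")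
        case True
        then have "B \<inter> ?G = {}"
          unfolding 2 cylinder_def by auto
        then show ?thesis by (simp add: d_def)
      next
        case False
        define g where "g = f(q := k, q + s := j)"
        have "q + s \<notin> T"
          using 2 s by auto
        then have g: "g x = f x" if "x \<in> T" for x
          using False that by (auto simp: g_def)
        have g_q: "g q = k" and g_qs: "g (q + s) = j"
          using s by (auto simp: g_def)
        have BG: "B \<inter> ?G = cylinder (insert q T) g"
          unfolding 2 cylinder_def by (auto simp: g g_q)
        have BGH: "B \<inter> ?G \<inter> ?H = cylinder (insert (q + s) (insert q T)) g"
          unfolding BG unfolding cylinder_def by (auto simp: g_qs)
        have "measure M (cylinder (insert (q + s) (insert q T)) g) =
            measure M (cylinder (insert q T) g) * mat_exp (- s *\<^sub>R A) $ g q $ g (q + s)"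
          using 2 q s by (intro markov_cylinder[OF law]) auto
        then show ?thesis
          unfolding d_def BGH unfolding BG g_q g_qs by simp
      qed
    qed
  qed
  then show ?thesis by (simp add: d_def)
qed

lemma markov_lower_bound:
  fixes A :: "real^'n^'n"
  assumes law: "is_path_law A a M" and q: "0 \<le> q" and s: "0 < s"
    and B: "B \<in> sets (path_filtration q)"
    and c: "\<And>k. c \<le> mat_exp (- s *\<^sub>R A) $ k $ j"
  shows "c * measure M B \<le> measure M (B \<inter> {\<omega> \<in> cadlag_paths. \<omega> (q + s) = j})"
proof -
  interpret prob_space M using law by (rule path_law_prob_space)
  let ?G = "\<lambda>k. {\<omega> \<in> cadlag_paths. \<omega> q = k}" and ?H = "{\<omega> \<in> cadlag_paths. \<omega> (q + s) = j}"
  have G: "?G k \<in> sets M" for k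
    using q coordinate_set_in_path_sigma[of q k] unfolding path_law_sets[OF law] by auto
  have H: "?H \<in> sets M"
    using q s coordinate_set_in_path_sigma[of "q + s" j] unfolding path_law_sets[OF law] by auto
  have BM: "B \<in> sets M"
    using B sets_path_filtration_path_sigma unfolding path_law_sets[OF law] by blast
  have split: "measure M C = (\<Sum>k\<in>UNIV. measure M (C \<inter> ?G k))" if C: "C \<in> sets M" for C
  proof -
    have "C \<subseteq> cadlag_paths"
      using sets.sets_into_space[OF C] path_law_space[OF law] by simp
    then have "(\<Union>k\<in>UNIV. C \<inter> ?G k) = C" by auto
    moreover have "measure M (\<Union>k\<in>UNIV. C \<inter> ?G k) = (\<Sum>k\<in>UNIV. measure M (C \<inter> ?G k))"
      using C G by (intro finite_measure_finite_Union) (auto simp: disjoint_family_on_def)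
    ultimately show ?thesis by (simp only:)
  qed
  have "c * measure M B = (\<Sum>k\<in>UNIV. measure M (B \<inter> ?G k) * c)"
    unfolding split[OF BM] sum_distrib_left by (simp add: mult.commute)
  also have "\<dots> \<le> (\<Sum>k\<in>UNIV. measure M (B \<inter> ?G k) * mat_exp (- s *\<^sub>R A) $ k $ j)"
    by (intro sum_mono mult_left_mono c) auto
  also have "\<dots> = (\<Sum>k\<in>UNIV. measure M (B \<inter> ?H \<inter> ?G k))"
    using markov_property[OF law q s B] by (simp add: Int_ac)
  also have "\<dots> = measure M (B \<inter> ?H)"
    using BM H by (subst split) auto
  finally show ?thesis .
qed

section \<open>The path at a random time\<close>

text \<open>The index \<open>l\<close> of the smallest point \<open>l / (n + 1)\<close> of the grid that is not below \<open>x\<close>.  Rounding up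
  with a non-strict inequality ties the grid index to events of the form \<open>{\<sigma> \<le> q}\<close>, which are the
  ones that a filtration controls.\<close>
definition grid_ceiling :: "nat \<Rightarrow> real \<Rightarrow> nat" where
  "grid_ceiling n x = nat \<lceil>x * real (Suc n)\<rceil>"

lemma grid_ceiling_le_iff: "grid_ceiling n x \<le> l \<longleftrightarrow> x \<le> real l / real (Suc n)"
  unfolding grid_ceiling_def by (subst pos_le_divide_eq) (simp_all only: nat_le_iff ceiling_le_iff of_int_of_nat_eq of_nat_0_less_iff zero_less_Suc)

lemma grid_ceiling_lower: "x \<le> real (grid_ceiling n x) / real (Suc n)"
  using grid_ceiling_le_iff[of n x "grid_ceiling n x"] by simp

lemma grid_ceiling_upper:
  assumes "0 \<le> x"
  shows "real (grid_ceiling n x) / real (Suc n) \<le> x + 1 / real (Suc n)"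
proof -
  have "real (grid_ceiling n x) \<le> x * real (Suc n) + 1"
    using assms ceiling_correct[of "x * real (Suc n)"] unfolding grid_ceiling_def
    by (simp add: of_nat_nat del: of_nat_Suc)
  then show ?thesis
    by (simp add: field_simps del: of_nat_Suc)
qed

lemma grid_ceiling_tendsto:
  assumes "0 \<le> x"
  shows "(\<lambda>n. real (grid_ceiling n x) / real (Suc n)) \<longlonglongrightarrow> x"
proof (rule tendsto_sandwich)
  show "\<forall>\<^sub>F n in sequentially. x \<le> real (grid_ceiling n x) / real (Suc n)"
    using grid_ceiling_lower by simp
  show "\<forall>\<^sub>F n in sequentially. real (grid_ceiling n x) / real (Suc n) \<le> x + 1 / real (Suc n)"
    using grid_ceiling_upper[OF assms] by simp
  show "(\<lambda>n. x + 1 / real (Suc n)) \<longlonglongrightarrow> x"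
    using tendsto_add[OF tendsto_const[of x] LIMSEQ_inverse_real_of_nat]
    by (simp add: divide_inverse)
qed simp

text \<open>In a discrete space, right continuity means that a path is constant on a short interval to the
  right of \<open>t\<close>.\<close>
lemma cadlag_eventually_eq:
  assumes \<omega>: "\<omega> \<in> cadlag_paths" and t: "0 \<le> t"
    and lim: "u \<longlonglongrightarrow> t" and ge: "\<And>n::nat. t \<le> u n"
  shows "\<forall>\<^sub>F n in sequentially. \<omega> (u n) = \<omega> t"
proof -
  have "limitin (discrete_topology UNIV) \<omega> (\<omega> t) (at_right t)"
    using \<omega> t unfolding cadlag_paths_def by auto
  then have "\<forall>\<^sub>F x in at_right t. \<omega> x \<in> {\<omega> t}"
    by (rule limitinD) auto
  then obtain b where b: "t < b" "\<And>x. t < x \<Longrightarrow> x < b \<Longrightarrow> \<omega> x = \<omega> t"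
    unfolding eventually_at_right_field by auto
  from lim b(1) have "\<forall>\<^sub>F n in sequentially. u n < b"
    by (rule order_tendstoD)
  then show ?thesis
  proof eventually_elim
    case (elim n)
    then show ?case
      using b(2)[of "u n"] ge[of n] by (cases "u n = t") auto
  qed
qed

lemma coordinate_measurable:
  assumes "0 \<le> s"
  shows "(\<lambda>\<omega>. \<omega> s) \<in> path_sigma \<rightarrow>\<^sub>M count_space (UNIV :: 'n::finite set)"
proof (subst measurable_count_space_eq2, simp, intro conjI ballI)
  fix i :: 'n
  have "(\<lambda>\<omega>. \<omega> s) -` {i} \<inter> space path_sigma = {\<omega> \<in> cadlag_paths. \<omega> s = i}"
    unfolding space_path_sigma by auto
  then show "(\<lambda>\<omega>. \<omega> s) -` {i} \<inter> space path_sigma \<in> sets path_sigma"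
    using coordinate_set_in_path_sigma[OF assms] by simp
qed auto

lemma grid_ceiling_measurable [measurable]: "grid_ceiling n \<in> borel \<rightarrow>\<^sub>M count_space UNIV"
  unfolding grid_ceiling_def by measurable

lemma grid_time_measurable:
  assumes \<sigma>: "\<sigma> \<in> borel_measurable path_sigma" and s: "0 \<le> s"
  shows "(\<lambda>\<omega>. \<omega> (s + real (grid_ceiling n (\<sigma> \<omega>)) / real (Suc n))) \<in>
    path_sigma \<rightarrow>\<^sub>M count_space (UNIV :: 'n::finite set)"
proof (rule measurable_compose_countable[where f = "\<lambda>l \<omega>. \<omega> (s + real l / real (Suc n))"])
  show "(\<lambda>\<omega>. \<omega> (s + real l / real (Suc n))) \<in> path_sigma \<rightarrow>\<^sub>M count_space (UNIV :: 'n set)" for l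
    using s by (intro coordinate_measurable) simp
  show "(\<lambda>\<omega>. grid_ceiling n (\<sigma> \<omega>)) \<in> path_sigma \<rightarrow>\<^sub>M count_space UNIV"
    using \<sigma> by measurable
qed

text \<open>On a grid the random time takes countably many values, so the state there is measurable; by
  right continuity the state at \<open>\<tau>\<close> is the eventual value along finer and finer grids.\<close>
lemma random_time_set_measurable:
  fixes \<tau> :: "(real \<Rightarrow> 'n::finite) \<Rightarrow> real"
  assumes \<tau>: "\<tau> \<in> borel_measurable path_sigma" "\<And>\<omega>. \<omega> \<in> cadlag_paths \<Longrightarrow> 0 \<le> \<tau> \<omega>"
  shows "{\<omega> \<in> cadlag_paths. \<omega> (\<tau> \<omega>) = j} \<in> sets path_sigma"
proof -
  define X where "X n \<omega> = \<omega> (real (grid_ceiling n (\<tau> \<omega>)) / real (Suc n))"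
    for n and \<omega> :: "real \<Rightarrow> 'n"
  have [measurable]: "X n \<in> path_sigma \<rightarrow>\<^sub>M count_space UNIV" for n
    using grid_time_measurable[OF \<tau>(1), of 0 n] unfolding X_def by simp
  have "(\<forall>\<^sub>F n in sequentially. X n \<omega> = j) \<longleftrightarrow> \<omega> (\<tau> \<omega>) = j" if "\<omega> \<in> cadlag_paths" for \<omega>
  proof -
    have ev: "\<forall>\<^sub>F n in sequentially. X n \<omega> = \<omega> (\<tau> \<omega>)"
      unfolding X_def
      by (rule cadlag_eventually_eq[OF that \<tau>(2)[OF that] grid_ceiling_tendsto[OF \<tau>(2)[OF that]]
            grid_ceiling_lower])
    show ?thesis
    proof
      assume "\<forall>\<^sub>F n in sequentially. X n \<omega> = j"
      with ev have "\<forall>\<^sub>F n::nat in sequentially. \<omega> (\<tau> \<omega>) = j"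
        by eventually_elim simp
      then show "\<omega> (\<tau> \<omega>) = j" by simp
    qed (use ev in simp)
  qed
  then have "{\<omega> \<in> cadlag_paths. \<omega> (\<tau> \<omega>) = j} =
      {\<omega> \<in> space path_sigma. \<exists>N. \<forall>n\<in>{N..}. X n \<omega> = j}"
    unfolding space_path_sigma eventually_sequentially Ball_def atLeast_iff by blast
  also have "\<dots> \<in> sets path_sigma"
    by measurable
  finally show ?thesis .
qed

lemma vector_matrix_mult_axis:
  fixes M :: "real^'n^'n"
  shows "(axis i 1 v* M) $ j = M $ i $ j"
  by (simp add: vector_matrix_mult_def axis_def if_distrib if_distribR cong: if_cong)

text \<open>The defining property of \<open>exp(-A\<tau>)\<close> at the unit vectors determines its rows; by linearity of the
  law in the initial vector, these rows then work for every \<open>a\<close>.\<close>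
lemma stopped_matrix_entry:
  fixes A :: "real^'n^'n"
  assumes law: "\<And>a. a \<in> prob_simplex \<Longrightarrow> is_path_law A a (P a)"
    and \<tau>: "\<tau> \<in> borel_measurable path_sigma" "\<And>\<omega>. \<omega> \<in> cadlag_paths \<Longrightarrow> 0 \<le> \<tau> \<omega>"
  shows "stopped_matrix P \<tau> $ i $ j = measure (P (axis i 1)) {\<omega> \<in> cadlag_paths. \<omega> (\<tau> \<omega>) = j}"
proof -
  let ?S = "\<lambda>j. {\<omega> \<in> cadlag_paths. \<omega> (\<tau> \<omega>) = j}"
  define M :: "real^'n^'n" where "M = (\<chi> i j. measure (P (axis i 1)) (?S j))"
  have S: "?S j \<in> sets path_sigma" for j
    using \<tau> by (rule random_time_set_measurable)
  have row_sum: "(\<Sum>j\<in>UNIV. measure (P (axis i 1)) (?S j)) = 1" for i :: 'n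
  proof -
    note law_i = law[OF axis_in_prob_simplex, of i]
    interpret prob_space "P (axis i 1)"
      using law_i by (rule path_law_prob_space)
    have "(\<Sum>j\<in>UNIV. prob (?S j)) = prob (\<Union>j\<in>UNIV. ?S j)"
      using S unfolding path_law_sets[OF law_i, symmetric]
      by (intro finite_measure_finite_Union[symmetric]) (auto simp: disjoint_family_on_def)
    also have "(\<Union>j\<in>UNIV. ?S j) = space (P (axis i 1))"
      unfolding path_law_space[OF law_i] by auto
    finally show ?thesis by (simp add: prob_space)
  qed
  have "stopped_matrix P \<tau> = M"
    unfolding stopped_matrix_def
  proof (rule the_equality, intro conjI ballI allI)
    show "stochastic_matrix M"
      using row_sum unfolding stochastic_matrix_def prob_simplex_def row_def M_def by simp
    show "(a v* M) $ j = measure (P a) (?S j)" if "a \<in> prob_simplex" for a j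
      using path_law_linear[OF law that S, of j]
      by (simp add: M_def vector_matrix_mult_def mult.commute)
  next
    fix N :: "real^'n^'n"
    assume "stochastic_matrix N \<and> (\<forall>a\<in>prob_simplex. \<forall>j. (a v* N) $ j = measure (P a) (?S j))"
    then have "N $ i $ j = M $ i $ j" for i j
      using axis_in_prob_simplex[of i] vector_matrix_mult_axis[of i N j] unfolding M_def by simp
    then show "N = M" by (simp add: vec_eq_iff)
  qed
  then show ?thesis by (simp add: M_def)
qed

lemma path_law_initial:
  fixes A :: "real^'n^'n"
  assumes "is_path_law A (axis i 1) M"
  shows "measure M {\<omega> \<in> cadlag_paths. \<omega> 0 = i} = 1"
proof -
  have "measure M (cylinder ((\<lambda>_. 0) ` {..0::nat}) (\<lambda>_. i)) = 1"
    by (subst path_law_cylinder[OF assms])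
      (auto simp: mat_exp_zero vector_matrix_mult_axis mat_def intro!: strict_mono_onI)
  then show ?thesis by (simp add: cylinder_def)
qed

text \<open>A null set of a mixture with positive weights is a null set of each component.\<close>
lemma almost_surely_AE_axis:
  fixes A :: "real^'n^'n"
  assumes law: "\<And>a. a \<in> prob_simplex \<Longrightarrow> is_path_law A a (P a)"
    and Q: "almost_surely P Q" and meas: "{\<omega> \<in> cadlag_paths. \<not> Q \<omega>} \<in> sets path_sigma"
  shows "AE \<omega> in P (axis i 1). Q \<omega>"
proof -
  let ?N = "{\<omega> \<in> cadlag_paths. \<not> Q \<omega>}"
  obtain a where a: "a \<in> prob_simplex" "\<And>k. 0 < a $ k" "AE \<omega> in P a. Q \<omega>"
    using Q unfolding almost_surely_def by blast
  note law_a = law[OF a(1)] and law_i = law[OF axis_in_prob_simplex, of i]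
  have "emeasure (P a) ?N = 0"
    using a(3) meas AE_iff_measurable[of ?N "P a" Q]
    unfolding path_law_space[OF law_a] path_law_sets[OF law_a] by simp
  then have "(\<Sum>k\<in>UNIV. a $ k * measure (P (axis k 1)) ?N) = 0"
    using path_law_linear[OF law a(1) meas] by (simp add: measure_def)
  then have "\<forall>k\<in>UNIV. a $ k * measure (P (axis k 1)) ?N = 0"
    using a(2) by (subst (asm) sum_nonneg_eq_0_iff) (auto intro!: mult_nonneg_nonneg less_imp_le[OF a(2)])
  then have "measure (P (axis i 1)) ?N = 0"
    using a(2)[of i] by (metis UNIV_I less_irrefl mult_eq_0_iff)
  moreover have "finite_measure (P (axis i 1))"
    using path_law_prob_space[OF law_i] by (rule prob_space.finite_measure)
  ultimately have "emeasure (P (axis i 1)) ?N = 0"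
    by (simp add: finite_measure.emeasure_eq_measure)
  then show ?thesis
    using meas AE_iff_measurable[of ?N "P (axis i 1)" Q]
    unfolding path_law_space[OF law_i] path_law_sets[OF law_i] by simp
qed

section \<open>The lower bound\<close>

text \<open>Here \<open>\<sigma>\<close> is only required to be a stopping time on \<open>D\<close>, and the rounded time takes the value
  \<open>q\<close> on an event of \<open>D\<close> known at time \<open>q\<close>.  Summing the fixed-time bound over the grid
  gives the bound for the rounded time.\<close>
lemma markov_lower_bound_on_grid:
  fixes A :: "real^'n^'n"
  assumes law: "is_path_law A a M" and \<epsilon>: "0 < \<epsilon>"
    and D: "D \<subseteq> cadlag_paths"
    and past: "\<And>s. 0 \<le> s \<Longrightarrow> {\<omega> \<in> D. \<sigma> \<omega> \<le> s} \<in> sets (path_filtration s)"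
    and c: "\<And>k. c \<le> mat_exp (- \<epsilon> *\<^sub>R A) $ k $ j"
  shows "c * measure M D \<le>
    measure M {\<omega> \<in> D. \<omega> (\<epsilon> + real (grid_ceiling n (\<sigma> \<omega>)) / real (Suc n)) = j}"
proof -
  interpret prob_space M using law by (rule path_law_prob_space)
  note sets_M = path_law_sets[OF law]
  define q where "q l = real l / real (Suc n)" for l
  define B where "B l = {\<omega> \<in> D. grid_ceiling n (\<sigma> \<omega>) = l}" for l
  define H where "H l = {\<omega> \<in> cadlag_paths. \<omega> (q l + \<epsilon>) = j}" for l
  have q0: "0 \<le> q l" for l by (simp add: q_def)
  have le: "{\<omega> \<in> D. grid_ceiling n (\<sigma> \<omega>) \<le> l} \<in> sets (path_filtration (q l))" for l
    unfolding grid_ceiling_le_iff using past[OF q0] unfolding q_def .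
  have B_past: "B l \<in> sets (path_filtration (q l))" for l
  proof (cases l)
    case 0
    then show ?thesis using le[of 0] by (simp add: B_def)
  next
    case (Suc l')
    have "B l = {\<omega> \<in> D. grid_ceiling n (\<sigma> \<omega>) \<le> l} - {\<omega> \<in> D. grid_ceiling n (\<sigma> \<omega>) \<le> l'}"
      unfolding B_def Suc by auto
    moreover have "q l' \<le> q l"
      unfolding q_def Suc by (simp add: divide_right_mono)
    then have "{\<omega> \<in> D. grid_ceiling n (\<sigma> \<omega>) \<le> l'} \<in> sets (path_filtration (q l))"
      using le[of l'] sets_path_filtration_mono by blast
    ultimately show ?thesis
      using le[of l] by (simp only: sets.Diff)
  qed
  have B_M: "B l \<in> sets M" for l
    using B_past sets_path_filtration_path_sigma unfolding sets_M by blast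
  have H_M: "H l \<in> sets M" for l
    unfolding sets_M H_def using q0[of l] \<epsilon> by (intro coordinate_set_in_path_sigma) simp
  have "(\<lambda>l. measure M (B l)) sums measure M (\<Union>l. B l)"
    using B_M by (intro finite_measure_UNION) (auto simp: disjoint_family_on_def B_def)
  also have "(\<Union>l. B l) = D"
    by (auto simp: B_def)
  finally have sum_B: "(\<lambda>l. c * measure M (B l)) sums (c * measure M D)"
    by (rule sums_mult)
  have "(\<lambda>l. measure M (B l \<inter> H l)) sums measure M (\<Union>l. B l \<inter> H l)"
    using B_M H_M by (intro finite_measure_UNION) (auto simp: disjoint_family_on_def B_def)
  also have "(\<Union>l. B l \<inter> H l) =
      {\<omega> \<in> D. \<omega> (\<epsilon> + real (grid_ceiling n (\<sigma> \<omega>)) / real (Suc n)) = j}"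
    using D by (auto simp: B_def H_def q_def add.commute)
  finally have sum_BH: "(\<lambda>l. measure M (B l \<inter> H l)) sums
      measure M {\<omega> \<in> D. \<omega> (\<epsilon> + real (grid_ceiling n (\<sigma> \<omega>)) / real (Suc n)) = j}" .
  have "c * measure M (B l) \<le> measure M (B l \<inter> H l)" for l
    unfolding H_def by (rule markov_lower_bound[OF law q0 \<epsilon> B_past c])
  then show ?thesis
    using sum_B sum_BH by (rule sums_le)
qed

text \<open>The bounds along the grids survive the limit because the indicators of the events at the rounded
  times converge almost surely to the indicator of the event at \<open>\<tau>\<close>.  Rounding \<open>\<tau> - \<epsilon>\<close> works as
  intended only where it is nonnegative, hence the hypothesis that \<open>\<tau> \<ge> \<epsilon>\<close> almost surely.\<close>
lemma path_law_random_time_lower_bound: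
  fixes A :: "real^'n^'n"
  assumes law: "is_path_law A a M" and \<epsilon>: "0 < \<epsilon>"
    and \<tau>: "\<tau> \<in> borel_measurable path_sigma" "\<And>\<omega>. \<omega> \<in> cadlag_paths \<Longrightarrow> 0 \<le> \<tau> \<omega>"
    and D: "D \<in> sets path_sigma" "measure M D = 1"
    and late: "AE \<omega> in M. \<omega> \<in> D \<longrightarrow> \<epsilon> \<le> \<tau> \<omega>"
    and past: "\<And>t. \<epsilon> \<le> t \<Longrightarrow> {\<omega> \<in> D. \<tau> \<omega> \<le> t} \<in> sets (path_filtration (t - \<epsilon>))"
    and c: "\<And>k. c \<le> mat_exp (- \<epsilon> *\<^sub>R A) $ k $ j"
  shows "c \<le> measure M {\<omega> \<in> cadlag_paths. \<omega> (\<tau> \<omega>) = j}"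
proof -
  interpret prob_space M using law by (rule path_law_prob_space)
  note sets_M = path_law_sets[OF law] and space_M = path_law_space[OF law]
  have D_sub: "D \<subseteq> cadlag_paths"
    using sets.sets_into_space[OF D(1)] unfolding space_path_sigma .
  define \<sigma> where "\<sigma> \<omega> = \<tau> \<omega> - \<epsilon>" for \<omega>
  have \<sigma>: "\<sigma> \<in> borel_measurable path_sigma"
    unfolding \<sigma>_def using \<tau>(1) by measurable
  define u where "u n \<omega> = \<epsilon> + real (grid_ceiling n (\<sigma> \<omega>)) / real (Suc n)" for n \<omega>
  define C where "C n = {\<omega> \<in> D. \<omega> (u n \<omega>) = j}" for n
  let ?S = "{\<omega> \<in> cadlag_paths. \<omega> (\<tau> \<omega>) = j}"
  have S: "?S \<in> sets M"
    unfolding sets_M using \<tau> by (rule random_time_set_measurable)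
  have C: "C n \<in> sets M" for n
  proof -
    have [measurable]: "(\<lambda>\<omega>. \<omega> (u n \<omega>)) \<in> path_sigma \<rightarrow>\<^sub>M count_space (UNIV :: 'n set)"
      unfolding u_def using grid_time_measurable[OF \<sigma>] \<epsilon> by simp
    have "{\<omega> \<in> space path_sigma. \<omega> (u n \<omega>) = j} \<in> sets path_sigma"
      by measurable
    then have "D \<inter> {\<omega> \<in> space path_sigma. \<omega> (u n \<omega>) = j} \<in> sets path_sigma"
      using D(1) by blast
    moreover have "C n = D \<inter> {\<omega> \<in> space path_sigma. \<omega> (u n \<omega>) = j}"
      using D_sub unfolding C_def space_path_sigma by auto
    ultimately show ?thesis unfolding sets_M by simp
  qed
  have past_\<sigma>: "{\<omega> \<in> D. \<sigma> \<omega> \<le> s} \<in> sets (path_filtration s)" if "0 \<le> s" for s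
    using past[of "s + \<epsilon>"] that unfolding \<sigma>_def by (simp add: diff_le_eq)
  have bound: "c \<le> measure M (C n)" for n
    using markov_lower_bound_on_grid[OF law \<epsilon> D_sub past_\<sigma> c, of n] D(2)
    unfolding C_def u_def by simp
  have "AE \<omega> in M. \<omega> \<in> D"
    using D by (subst AE_in_set_eq_1) (simp_all add: sets_M)
  then have ae: "AE \<omega> in M. (\<lambda>n. indicat_real (C n) \<omega>) \<longlonglongrightarrow> indicat_real ?S \<omega>"
    using late
  proof eventually_elim
    case (elim \<omega>)
    then have \<omega>: "\<omega> \<in> cadlag_paths" and \<sigma>0: "0 \<le> \<sigma> \<omega>"
      using D_sub by (auto simp: \<sigma>_def)
    have "(\<lambda>n. u n \<omega>) \<longlonglongrightarrow> \<tau> \<omega>"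
      using tendsto_add[OF tendsto_const[of \<epsilon>] grid_ceiling_tendsto[OF \<sigma>0]]
      unfolding u_def by (simp add: \<sigma>_def)
    moreover have "\<tau> \<omega> \<le> u n \<omega>" for n
      using grid_ceiling_lower[of "\<sigma> \<omega>" n] unfolding u_def \<sigma>_def by simp
    ultimately have "\<forall>\<^sub>F n in sequentially. \<omega> (u n \<omega>) = \<omega> (\<tau> \<omega>)"
      using cadlag_eventually_eq[OF \<omega> \<tau>(2)[OF \<omega>]] by blast
    then have "\<forall>\<^sub>F n in sequentially. indicat_real (C n) \<omega> = indicat_real ?S \<omega>"
      by eventually_elim (use elim \<omega> in \<open>simp add: C_def indicator_def\<close>)
    then show ?case
      by (rule tendsto_eventually)
  qed
  have "(\<lambda>n. integral\<^sup>L M (indicat_real (C n))) \<longlonglongrightarrow> integral\<^sup>L M (indicat_real ?S)"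
    using ae by (intro integral_dominated_convergence[where w = "\<lambda>_. 1"])
      (use S C in \<open>auto simp: indicator_def\<close>)
  then have "(\<lambda>n. measure M (C n)) \<longlonglongrightarrow> measure M ?S"
    using S C sets.sets_into_space by (simp add: Int_absorb1 Int_absorb2)
  then show ?thesis
    using bound by (intro LIMSEQ_le_const) auto
qed

theorem proposition3p6:
  fixes A :: "real^'n^'n" and \<epsilon> :: real
  assumes "2 \<le> CARD('n)"
    and "coupling_matrix A"
    and "0 < \<epsilon>"
  shows "\<exists>\<rho>>0. \<forall>P. (\<forall>a\<in>prob_simplex. is_path_law A a (P a)) \<longrightarrow>
           (\<forall>i \<tau>. path_stopping_time \<tau> \<longrightarrow> well_after P i \<tau> \<epsilon> \<longrightarrow>
             (\<forall>j. stopped_matrix P \<tau> $ i $ j > \<rho>))"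
proof -
  define c where "c = Min (range (\<lambda>(k, j). mat_exp (- \<epsilon> *\<^sub>R A) $ k $ j))"
  have c_le: "c \<le> mat_exp (- \<epsilon> *\<^sub>R A) $ k $ j" for k j
    unfolding c_def by (rule Min_le) (auto intro!: image_eqI[of _ _ "(k, j)"])
  have c_pos: "0 < c"
    unfolding c_def using mat_exp_coupling_pos[OF assms(2,3)] by (subst Min_gr_iff) auto
  show ?thesis
  proof (intro exI[of _ "c / 2"] conjI allI impI)
    \<comment> \<open>The argument yields \<open>c \<le> \<dots>\<close>; halving makes the inequality strict.\<close>
    show "0 < c / 2" using c_pos by simp
    fix P :: "real^'n \<Rightarrow> (real \<Rightarrow> 'n) measure" and i j :: 'n and \<tau> :: "(real \<Rightarrow> 'n) \<Rightarrow> real"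
    assume "\<forall>a\<in>prob_simplex. is_path_law A a (P a)"
      and st: "path_stopping_time \<tau>" and wa: "well_after P i \<tau> \<epsilon>"
    then have law: "is_path_law A a (P a)" if "a \<in> prob_simplex" for a
      using that by blast
    have \<tau>: "\<tau> \<in> borel_measurable path_sigma" "\<And>\<omega>. \<omega> \<in> cadlag_paths \<Longrightarrow> 0 \<le> \<tau> \<omega>"
      using st unfolding path_stopping_time_def by auto
    let ?D = "{\<omega> \<in> cadlag_paths. \<omega> 0 = i}"
    have D: "?D \<in> sets path_sigma"
      by (rule coordinate_set_in_path_sigma) simp
    note law_i = law[OF axis_in_prob_simplex, of i]
    have "{\<omega> \<in> space path_sigma. \<tau> \<omega> < \<epsilon>} \<in> sets path_sigma"
      using \<tau>(1) by measurable
    with D have "?D \<inter> {\<omega> \<in> space path_sigma. \<tau> \<omega> < \<epsilon>} \<in> sets path_sigma"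
      by blast
    also have "?D \<inter> {\<omega> \<in> space path_sigma. \<tau> \<omega> < \<epsilon>} =
        {\<omega> \<in> cadlag_paths. \<not> (\<omega> 0 = i \<longrightarrow> \<epsilon> \<le> \<tau> \<omega>)}"
      unfolding space_path_sigma by auto
    finally have "AE \<omega> in P (axis i 1). \<omega> 0 = i \<longrightarrow> \<epsilon> \<le> \<tau> \<omega>"
      using wa unfolding well_after_def by (intro almost_surely_AE_axis[OF law]) auto
    then have late: "AE \<omega> in P (axis i 1). \<omega> \<in> ?D \<longrightarrow> \<epsilon> \<le> \<tau> \<omega>"
      by eventually_elim auto
    have past: "{\<omega> \<in> ?D. \<tau> \<omega> \<le> t} \<in> sets (path_filtration (t - \<epsilon>))" if "\<epsilon> \<le> t" for t
    proof -
      have "{\<omega> \<in> ?D. \<tau> \<omega> \<le> t} = {\<omega> \<in> cadlag_paths. \<tau> \<omega> \<le> t} \<inter> ?D"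
        by auto
      then show ?thesis
        using wa that unfolding well_after_def by simp
    qed
    have "c \<le> measure (P (axis i 1)) {\<omega> \<in> cadlag_paths. \<omega> (\<tau> \<omega>) = j}"
      by (rule path_law_random_time_lower_bound[OF law_i assms(3) \<tau> D path_law_initial[OF law_i]
            late past c_le])
    also have "\<dots> = stopped_matrix P \<tau> $ i $ j"
      by (rule stopped_matrix_entry[OF law \<tau>, symmetric])
    finally show "c / 2 < stopped_matrix P \<tau> $ i $ j"
      using c_pos by simp
  qed
qed

end
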